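(* Let $\mathbf{A}$ be a finite algebra with universe $A$, let $\mathcal{V}=\mathcal{V}(\mathbf{A})$ be the variety generated by $\mathbf{A}$, and let $\mathbf{F}_n(\mathcal{V})$ be the free algebra of rank $n$ in $\mathcal{V}$. Then, for every $n\ge |A|$, $\mathbf{A}$ is finitely related if and only if $\mathbf{F}_n(\mathcal{V})$ is finitely related.
   Context: An algebra is a nonempty universe together with a set of basic operations. Operations in clones have finite arity at least $1$, and relations have finite arity. A clone on a set $B$ is a set of finitary operations on $B$ containing all projections $\pi_i^n(x_1,\dots,x_n)=x_i$ and closed under composition $f(g_1,\dots,g_m)$ ($f$ an $m$-ary member, $g_1,\dots,g_m$ members of a common arity). A $k$-ary operation $f$ on $B$ preserves $R\subseteq B^r$ if applying $f$ coordinatewise to any $k$ tuples of $R$ gives a tuple in $R$. $\mathrm{Pol}(R_1,\dots,R_k)$ is the set of operations preserving all $R_i$. A clone on $B$ is finitely related if it equals $\mathrm{Pol}(R_1,\dots,R_k)$ for finitely many relations $R_1,\dots,R_k$ on $B$. The term clone $\mathrm{Clo}(\mathbf{B})$ of an algebra $\mathbf{B}$ is the set of all term operations on $\mathbf{B}$; it is a clone on the universe $B$. The algebra $\mathbf{B}$ is finitely related if $\mathrm{Clo}(\mathbf{B})$ is finitely related. $\mathcal{V}(\mathbf{A})$ is the class of all algebras of the same signature as $\mathbf{A}$ satisfying every identity $t\approx s$ that holds in $\mathbf{A}$. The free algebra $\mathbf{F}_n(\mathcal{V}(\mathbf{A}))$ on $n$ generators is the quotient of the set of all $n$-ary terms (in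 variables $x_1,\dots,x_n$) by the equivalence $t\sim s \iff \mathbf{A}\models t\approx s$, with operations induced by term formation. Equivalently, it is characterized by the universal property that for every $\mathbf{B}\in\mathcal{V}(\mathbf{A})$ every map $\{x_1,\dots,x_n\}\to B$ extends uniquely to a homomorphism $\mathbf{F}_n(\mathcal{V}(\mathbf{A}))\to\mathbf{B}$. *)

theory Defs
  imports "HOL-Library.FuncSet"
begin

section \<open>Operations, clones and relations on a set\<close>

definition tuples :: "'a set \<Rightarrow> nat \<Rightarrow> 'a list set" where
  "tuples B n = {xs. length xs = n \<and> set xs \<subseteq> B}"

text \<open>An operation is tagged with its arity, and is made extensional (undefined off
  the tuples of that length) so that equality of operations is equality on \<open>B\<close>.\<close>

definition operations :: "'a set \<Rightarrow> (nat \<times> ('a list \<Rightarrow> 'a)) set" where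
  "operations B = {(n, f). 1 \<le> n \<and> f \<in> tuples B n \<rightarrow>\<^sub>E B}"

definition proj :: "'a set \<Rightarrow> nat \<Rightarrow> nat \<Rightarrow> 'a list \<Rightarrow> 'a" where
  "proj B n i = (\<lambda>xs\<in>tuples B n. xs ! i)"

definition superpose ::
  "'a set \<Rightarrow> nat \<Rightarrow> ('a list \<Rightarrow> 'a) \<Rightarrow> ('a list \<Rightarrow> 'a) list \<Rightarrow> 'a list \<Rightarrow> 'a" where
  "superpose B n f gs = (\<lambda>xs\<in>tuples B n. f (map (\<lambda>g. g xs) gs))"

definition clone :: "'a set \<Rightarrow> (nat \<times> ('a list \<Rightarrow> 'a)) set \<Rightarrow> bool" where
  "clone B C \<longleftrightarrow> C \<subseteq> operations B \<and>
     (\<forall>n. \<forall>i<n. (n, proj B n i) \<in> C) \<and>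
     (\<forall>m f n gs. (m, f) \<in> C \<and> length gs = m \<and> (\<forall>g\<in>set gs. (n, g) \<in> C)
        \<longrightarrow> (n, superpose B n f gs) \<in> C)"

definition relations :: "'a set \<Rightarrow> (nat \<times> 'a list set) set" where
  "relations B = {(r, R). R \<subseteq> tuples B r}"

definition preserves :: "nat \<times> ('a list \<Rightarrow> 'a) \<Rightarrow> nat \<times> 'a list set \<Rightarrow> bool" where
  "preserves = (\<lambda>(k, f) (r, R). \<forall>ts. length ts = k \<and> set ts \<subseteq> R \<longrightarrow>
     map (\<lambda>j. f (map (\<lambda>t. t ! j) ts)) [0..<r] \<in> R)"

definition Pol :: "'a set \<Rightarrow> (nat \<times> 'a list set) set \<Rightarrow> (nat \<times> ('a list \<Rightarrow> 'a)) set" where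
  "Pol B Rs = {f \<in> operations B. \<forall>R\<in>Rs. preserves f R}"

definition finitely_related_clone :: "'a set \<Rightarrow> (nat \<times> ('a list \<Rightarrow> 'a)) set \<Rightarrow> bool" where
  "finitely_related_clone B C \<longleftrightarrow> clone B C \<and>
     (\<exists>Rs. finite Rs \<and> Rs \<subseteq> relations B \<and> C = Pol B Rs)"


section \<open>Algebras and terms\<close>

text \<open>The set of operation symbols may be empty or infinite, and nullary symbols are allowed.\<close>

record 'f signature =
  symbs :: "'f set"
  arity :: "'f \<Rightarrow> nat"

record ('f, 'a) ualgebra =
  univ :: "'a set"
  interp :: "'f \<Rightarrow> 'a list \<Rightarrow> 'a"

definition is_algebra :: "'f signature \<Rightarrow> ('f, 'a) ualgebra \<Rightarrow> bool" where
  "is_algebra \<Sigma> A \<longleftrightarrow> univ A \<noteq> {} \<and>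
     (\<forall>f\<in>symbs \<Sigma>. interp A f \<in> tuples (univ A) (arity \<Sigma> f) \<rightarrow> univ A)"

datatype 'f trm = Var nat | App 'f "'f trm list"

text \<open>The variables \<open>x\<^sub>1, \<dots>, x\<^sub>n\<close> are \<open>Var 0, \<dots>, Var (n - 1)\<close>.\<close>

inductive_set terms :: "'f signature \<Rightarrow> nat \<Rightarrow> 'f trm set" for \<Sigma> n where
  Var: "i < n \<Longrightarrow> Var i \<in> terms \<Sigma> n"
| App: "f \<in> symbs \<Sigma> \<Longrightarrow> length ts = arity \<Sigma> f \<Longrightarrow> \<forall>t\<in>set ts. t \<in> terms \<Sigma> n \<Longrightarrow>
    App f ts \<in> terms \<Sigma> n"

primrec term_eval :: "('f, 'a) ualgebra \<Rightarrow> (nat \<Rightarrow> 'a) \<Rightarrow> 'f trm \<Rightarrow> 'a" where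
  "term_eval A e (Var i) = e i"
| "term_eval A e (App f ts) = interp A f (map (term_eval A e) ts)"

definition term_op :: "('f, 'a) ualgebra \<Rightarrow> nat \<Rightarrow> 'f trm \<Rightarrow> 'a list \<Rightarrow> 'a" where
  "term_op A n t = (\<lambda>xs\<in>tuples (univ A) n. term_eval A (\<lambda>i. xs ! i) t)"

definition Clo :: "'f signature \<Rightarrow> ('f, 'a) ualgebra \<Rightarrow> (nat \<times> ('a list \<Rightarrow> 'a)) set" where
  "Clo \<Sigma> A = {(n, term_op A n t) | n t. 1 \<le> n \<and> t \<in> terms \<Sigma> n}"

definition finitely_related :: "'f signature \<Rightarrow> ('f, 'a) ualgebra \<Rightarrow> bool" where
  "finitely_related \<Sigma> A \<longleftrightarrow> finitely_related_clone (univ A) (Clo \<Sigma> A)"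


section \<open>Free algebras in the variety generated by an algebra\<close>

definition satisfies :: "('f, 'a) ualgebra \<Rightarrow> 'f trm \<Rightarrow> 'f trm \<Rightarrow> bool" where
  "satisfies A s t \<longleftrightarrow> (\<forall>e. range e \<subseteq> univ A \<longrightarrow> term_eval A e s = term_eval A e t)"

definition term_equiv :: "'f signature \<Rightarrow> ('f, 'a) ualgebra \<Rightarrow> nat \<Rightarrow> ('f trm \<times> 'f trm) set" where
  "term_equiv \<Sigma> A n = {(s, t). s \<in> terms \<Sigma> n \<and> t \<in> terms \<Sigma> n \<and> satisfies A s t}"

text \<open>The union ranges over all choices of representatives of the argument classes;
  \<open>interp_free_algebra\<close> below shows that it is the class of a single term.\<close>

definition free_algebra ::
  "'f signature \<Rightarrow> ('f, 'a) ualgebra \<Rightarrow> nat \<Rightarrow> ('f, 'f trm set) ualgebra" where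
  "free_algebra \<Sigma> A n =
     \<lparr>univ = terms \<Sigma> n // term_equiv \<Sigma> A n,
      interp = (\<lambda>f cs. \<Union>ts\<in>listset cs. term_equiv \<Sigma> A n `` {App f ts})\<rparr>"


section \<open>Well-definedness\<close>

lemma equiv_term_equiv: "equiv (terms \<Sigma> n) (term_equiv \<Sigma> A n)"
proof (rule equivI)
  show "term_equiv \<Sigma> A n \<subseteq> terms \<Sigma> n \<times> terms \<Sigma> n"
    by (auto simp: term_equiv_def)
  show "refl_on (terms \<Sigma> n) (term_equiv \<Sigma> A n)"
    by (simp add: refl_on_def term_equiv_def satisfies_def)
  show "sym (term_equiv \<Sigma> A n)"
    by (simp add: sym_def term_equiv_def satisfies_def)
  show "trans (term_equiv \<Sigma> A n)"
    by (simp add: trans_def term_equiv_def satisfies_def)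
qed

lemma in_listset_iff: "ts \<in> listset cs \<longleftrightarrow> list_all2 (\<in>) ts cs"
  by (induction cs arbitrary: ts) (auto simp: set_Cons_def list_all2_Cons2)

lemma interp_free_algebra:
  assumes "f \<in> symbs \<Sigma>" "length ts = arity \<Sigma> f" "set ts \<subseteq> terms \<Sigma> n"
  shows "interp (free_algebra \<Sigma> A n) f (map (\<lambda>t. term_equiv \<Sigma> A n `` {t}) ts) =
    term_equiv \<Sigma> A n `` {App f ts}"
proof -
  let ?r = "term_equiv \<Sigma> A n"
  have eq: "?r `` {App f ss} = ?r `` {App f ts}"
    if "ss \<in> listset (map (\<lambda>t. ?r `` {t}) ts)" for ss
  proof -
    have l: "list_all2 (\<lambda>s t. (t, s) \<in> ?r) ss ts"
      using that by (simp add: in_listset_iff list_all2_map2)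
    have len: "length ss = length ts"
      using l by (rule list_all2_lengthD)
    have nth: "(ts ! i, ss ! i) \<in> ?r" if "i < length ts" for i
      using l that by (auto simp: list_all2_conv_all_nth)
    have "App f ss \<in> terms \<Sigma> n" "App f ts \<in> terms \<Sigma> n"
      using assms len nth by (auto intro!: terms.App simp: in_set_conv_nth term_equiv_def)
    moreover have "map (term_eval A e) ts = map (term_eval A e) ss"
      if "range e \<subseteq> univ A" for e
      using that len nth by (intro nth_equalityI) (auto simp: term_equiv_def satisfies_def)
    ultimately have "(App f ts, App f ss) \<in> ?r"
      by (auto simp: term_equiv_def satisfies_def)
    then show ?thesis
      using equiv_class_eq[OF equiv_term_equiv] by metis
  qed
  have "ts \<in> listset (map (\<lambda>t. ?r `` {t}) ts)"
    using assms(3)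
    by (auto simp: in_listset_iff list_all2_conv_all_nth term_equiv_def satisfies_def)
  then have "(\<Union>ss\<in>listset (map (\<lambda>t. ?r `` {t}) ts). ?r `` {App f ss}) = ?r `` {App f ts}"
    by (intro equalityI UN_least UN_upper equalityD1[OF eq])
  then show ?thesis
    by (simp only: free_algebra_def ualgebra.simps)
qed

lemma is_algebra_free_algebra:
  assumes "1 \<le> n"
  shows "is_algebra \<Sigma> (free_algebra \<Sigma> A n)"
  unfolding is_algebra_def
proof (intro conjI ballI funcsetI)
  have "Var 0 \<in> terms \<Sigma> n"
    using assms by (intro terms.Var) simp
  then show "univ (free_algebra \<Sigma> A n) \<noteq> {}"
    by (auto simp: free_algebra_def quotient_def)
next
  fix f cs
  assume f: "f \<in> symbs \<Sigma>"
    and cs: "cs \<in> tuples (univ (free_algebra \<Sigma> A n)) (arity \<Sigma> f)"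
  have "\<forall>c\<in>set cs. \<exists>t. t \<in> terms \<Sigma> n \<and> c = term_equiv \<Sigma> A n `` {t}"
    using cs by (auto simp: tuples_def free_algebra_def elim: quotientE)
  then obtain g where g: "\<forall>c\<in>set cs. g c \<in> terms \<Sigma> n \<and> c = term_equiv \<Sigma> A n `` {g c}"
    by metis
  have sub: "set (map g cs) \<subseteq> terms \<Sigma> n" and len: "length (map g cs) = arity \<Sigma> f"
    using g cs by (auto simp: tuples_def)
  have "cs = map (\<lambda>t. term_equiv \<Sigma> A n `` {t}) (map g cs)"
    using g by (simp add: map_idI)
  then have "interp (free_algebra \<Sigma> A n) f cs = term_equiv \<Sigma> A n `` {App f (map g cs)}"
    using interp_free_algebra[OF f len sub, of A] by (rule trans[OF arg_cong])
  moreover have "App f (map g cs) \<in> terms \<Sigma> n"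
    using f len sub by (intro terms.App) auto
  ultimately show "interp (free_algebra \<Sigma> A n) f cs \<in> univ (free_algebra \<Sigma> A n)"
    by (simp add: free_algebra_def quotientI)
qed

lemma term_eval_in_univ:
  assumes "is_algebra \<Sigma> A" "t \<in> terms \<Sigma> n" "\<forall>i<n. e i \<in> univ A"
  shows "term_eval A e t \<in> univ A"
  using assms(2)
proof (induction rule: terms.induct)
  case (App f ts)
  then have "map (term_eval A e) ts \<in> tuples (univ A) (arity \<Sigma> f)"
    by (auto simp: tuples_def)
  then show ?case
    using assms(1) App.hyps(1) by (auto simp: is_algebra_def)
qed (use assms(3) in auto)

primrec subst :: "(nat \<Rightarrow> 'f trm) \<Rightarrow> 'f trm \<Rightarrow> 'f trm" where
  "subst \<sigma> (Var i) = \<sigma> i"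
| "subst \<sigma> (App f ts) = App f (map (subst \<sigma>) ts)"

lemma subst_in_terms:
  assumes "t \<in> terms \<Sigma> m" "\<forall>i<m. \<sigma> i \<in> terms \<Sigma> n"
  shows "subst \<sigma> t \<in> terms \<Sigma> n"
  using assms(1)
proof (induction rule: terms.induct)
  case (App f ts)
  then show ?case by (auto intro!: terms.App)
qed (use assms(2) in auto)

lemma term_eval_subst: "term_eval A e (subst \<sigma> t) = term_eval A (\<lambda>i. term_eval A e (\<sigma> i)) t"
proof (induction t)
  case (App f ts)
  then have "map (term_eval A e \<circ> subst \<sigma>) ts = map (term_eval A (\<lambda>i. term_eval A e (\<sigma> i))) ts"
    by simp
  then show ?case by (simp only: subst.simps term_eval.simps map_map)
qed simp

lemma term_eval_cong:
  assumes "t \<in> terms \<Sigma> n" "\<forall>i<n. e i = e' i"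
  shows "term_eval A e t = term_eval A e' t"
  using assms(1)
proof (induction rule: terms.induct)
  case (App f ts)
  then have "map (term_eval A e) ts = map (term_eval A e') ts"
    by simp
  then show ?case by (simp only: term_eval.simps)
qed (use assms(2) in auto)

lemma clone_Clo:
  assumes "is_algebra \<Sigma> A"
  shows "clone (univ A) (Clo \<Sigma> A)"
  unfolding clone_def
proof (intro conjI allI impI)
  show "Clo \<Sigma> A \<subseteq> operations (univ A)"
  proof
    fix x assume "x \<in> Clo \<Sigma> A"
    then obtain n t where x: "x = (n, term_op A n t)" "1 \<le> n" "t \<in> terms \<Sigma> n"
      by (auto simp: Clo_def)
    have "term_eval A (\<lambda>i. xs ! i) t \<in> univ A" if "xs \<in> tuples (univ A) n" for xs
      using that by (intro term_eval_in_univ[OF assms x(3)]) (auto simp: tuples_def)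
    then show "x \<in> operations (univ A)"
      using x by (auto simp: operations_def term_op_def)
  qed
next
  fix n i :: nat assume "i < n"
  moreover have "proj (univ A) n i = term_op A n (Var i)"
    by (simp add: proj_def term_op_def)
  ultimately show "(n, proj (univ A) n i) \<in> Clo \<Sigma> A"
    by (auto simp: Clo_def intro!: exI[of _ "Var i"] terms.Var)
next
  fix m f n gs
  assume "(m, f) \<in> Clo \<Sigma> A \<and> length gs = m \<and> (\<forall>g\<in>set gs. (n, g) \<in> Clo \<Sigma> A)"
  then have f: "(m, f) \<in> Clo \<Sigma> A" and len: "length gs = m"
    and gs: "\<forall>g\<in>set gs. (n, g) \<in> Clo \<Sigma> A"
    by auto
  from f obtain t where t: "f = term_op A m t" "1 \<le> m" "t \<in> terms \<Sigma> m"
    by (auto simp: Clo_def)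
  have "\<forall>g\<in>set gs. \<exists>s. 1 \<le> n \<and> s \<in> terms \<Sigma> n \<and> g = term_op A n s"
    using gs by (auto simp: Clo_def)
  then obtain h where h: "\<forall>g\<in>set gs. 1 \<le> n \<and> h g \<in> terms \<Sigma> n \<and> g = term_op A n (h g)"
    by metis
  have n: "1 \<le> n"
    using h len t(2) by (cases gs) auto
  define \<sigma> where "\<sigma> = (\<lambda>i. h (gs ! i))"
  have \<sigma>: "\<sigma> i \<in> terms \<Sigma> n" "gs ! i = term_op A n (\<sigma> i)" if "i < m" for i
  proof -
    have "gs ! i \<in> set gs"
      using that len by simp
    then show "\<sigma> i \<in> terms \<Sigma> n" "gs ! i = term_op A n (\<sigma> i)"
      using h unfolding \<sigma>_def by blast+
  qed
  have "superpose (univ A) n f gs = term_op A n (subst \<sigma> t)"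
  proof
    fix xs
    show "superpose (univ A) n f gs xs = term_op A n (subst \<sigma> t) xs"
    proof (cases "xs \<in> tuples (univ A) n")
      case True
      have nth: "(gs ! i) xs = term_eval A (\<lambda>j. xs ! j) (\<sigma> i)" if "i < m" for i
        using \<sigma>(2)[OF that] True by (simp add: term_op_def)
      have "(gs ! i) xs \<in> univ A" if "i < m" for i
        unfolding nth[OF that] using True
        by (intro term_eval_in_univ[OF assms \<sigma>(1)[OF that]]) (auto simp: tuples_def)
      then have "map (\<lambda>g. g xs) gs \<in> tuples (univ A) m"
        using len by (auto simp: tuples_def in_set_conv_nth)
      then have "superpose (univ A) n f gs xs = term_eval A (\<lambda>i. map (\<lambda>g. g xs) gs ! i) t"
        using True t(1) by (simp add: superpose_def term_op_def)
      also have "\<dots> = term_eval A (\<lambda>i. term_eval A (\<lambda>j. xs ! j) (\<sigma> i)) t"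
        using nth len by (intro term_eval_cong[OF t(3)]) simp
      also have "\<dots> = term_op A n (subst \<sigma> t) xs"
        using True by (simp add: term_op_def term_eval_subst)
      finally show ?thesis .
    qed (simp add: superpose_def term_op_def)
  qed
  then show "(n, superpose (univ A) n f gs) \<in> Clo \<Sigma> A"
    using n subst_in_terms[OF t(3)] \<sigma>(1) by (auto simp: Clo_def)
qed

end

theory Submission
  imports Defs
begin

text \<open>
  A clone on a finite set is finitely related if and only if, for some \<open>k\<close>, it contains every
  operation all of whose \<open>k\<close>-ary minors it contains.  A relation with at most \<open>k\<close> tuples is
  preserved by an operation as soon as it is preserved by its \<open>k\<close>-ary minors, since every
  application to tuples of the relation involves at most \<open>k\<close> different ones; conversely the single relation that
  lists the value tables of the \<open>k\<close>-ary members of the clone recovers such a clone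
  (\<open>finitely_related_clone_iff\<close>).

  Now let \<open>B\<close> be a finite algebra with a set \<open>H\<close> of homomorphisms into \<open>A\<close> that separates the
  points of \<open>B\<close> and contains a surjection.  Call operations \<open>f'\<close> on \<open>A\<close> and \<open>f\<close> on \<open>B\<close> intertwined
  if \<open>f' \<circ> h = h \<circ> f\<close> for all \<open>h \<in> H\<close>.  Each determines the other, the two operations of one term
  are intertwined, and so \<open>f'\<close> is a term operation of \<open>A\<close> exactly when \<open>f\<close> is one of \<open>B\<close>.
  An operation on either side whose \<open>K\<close>-ary minors are term operations has a partner on the other
  side as soon as \<open>K \<ge> |B|\<^sup>2\<close>: the existence of a partner is a condition on at most two argument
  lists over \<open>B\<close> at a time, and these take at most \<open>|B|\<^sup>2\<close> different pairs of values, so that a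
  minor, hence a term, can be used in place of the operation.  Therefore the
  criterion holds for \<open>A\<close> if and only if it holds for \<open>B\<close>.

  The free algebra on \<open>n\<close> generators is such a \<open>B\<close>: the evaluations of terms in \<open>A\<close> separate its
  points by construction, and when \<open>n \<ge> |A|\<close> the generators can be sent onto \<open>A\<close>.
\<close>

section \<open>Finitely related clones and minors\<close>

definition minor :: "'a set \<Rightarrow> nat \<Rightarrow> nat \<Rightarrow> (nat \<Rightarrow> nat) \<Rightarrow> ('a list \<Rightarrow> 'a) \<Rightarrow> 'a list \<Rightarrow> 'a" where
  "minor B m k \<sigma> f = (\<lambda>xs\<in>tuples B k. f (map (\<lambda>i. xs ! \<sigma> i) [0..<m]))"

definition determined_by_minors :: "'a set \<Rightarrow> (nat \<times> ('a list \<Rightarrow> 'a)) set \<Rightarrow> nat \<Rightarrow> bool" where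
  "determined_by_minors B C k \<longleftrightarrow>
     (\<forall>(m, f)\<in>operations B. (\<forall>\<sigma>\<in>{..<m} \<rightarrow> {..<k}. (k, minor B m k \<sigma> f) \<in> C) \<longrightarrow> (m, f) \<in> C)"

lemma tuples_reindex:
  assumes "xs \<in> tuples B k" "\<sigma> \<in> {..<m} \<rightarrow> {..<k}"
  shows "map (\<lambda>i. xs ! \<sigma> i) [0..<m] \<in> tuples B m"
  using assms by (force simp: tuples_def Pi_iff subset_iff)

lemma tuples_map: "xs \<in> tuples B m \<Longrightarrow> h \<in> B \<rightarrow> A \<Longrightarrow> map h xs \<in> tuples A m"
  by (auto simp: tuples_def)

lemma finite_tuples: "finite B \<Longrightarrow> finite (tuples B n)"
  using finite_lists_length_eq[of B n] by (simp add: tuples_def conj_commute)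

text \<open>Every use of finiteness below comes down to this: a list with few different entries is
  obtained from a short list by reindexing.\<close>

lemma list_reindex_short:
  assumes "ts \<noteq> []" "card (set ts) \<le> k"
  obtains us \<sigma> where "length us = k" "set us \<subseteq> set ts"
    "\<sigma> \<in> {..<length ts} \<rightarrow> {..<k}" "ts = map (\<lambda>i. us ! \<sigma> i) [0..<length ts]"
proof -
  obtain vs where vs: "set vs = set ts" "distinct vs"
    using finite_distinct_list[of "set ts"] by auto
  have len: "length vs \<le> k"
    using assms(2) vs distinct_card by metis
  define us where "us = vs @ replicate (k - length vs) (hd ts)"
  have "\<forall>i<length ts. \<exists>j<length vs. vs ! j = ts ! i"
    using vs(1) by (metis in_set_conv_nth nth_mem)
  then obtain \<sigma> where \<sigma>: "\<forall>i<length ts. \<sigma> i < length vs \<and> vs ! \<sigma> i = ts ! i"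
    by metis
  show thesis
  proof
    show "length us = k"
      using len by (simp add: us_def)
    show "set us \<subseteq> set ts"
      using assms(1) by (simp add: us_def vs(1) set_replicate_conv_if)
    show "\<sigma> \<in> {..<length ts} \<rightarrow> {..<k}"
      using \<sigma> len by (auto intro: less_le_trans)
    show "ts = map (\<lambda>i. us ! \<sigma> i) [0..<length ts]"
      using \<sigma> by (intro nth_equalityI) (auto simp: us_def nth_append)
  qed
qed

lemma clone_minor:
  assumes "clone B C" "(m, f) \<in> C" "\<sigma> \<in> {..<m} \<rightarrow> {..<k}"
  shows "(k, minor B m k \<sigma> f) \<in> C"
proof -
  let ?gs = "map (\<lambda>i. proj B k (\<sigma> i)) [0..<m]"
  have "minor B m k \<sigma> f = superpose B k f ?gs"
    by (auto simp: minor_def superpose_def proj_def fun_eq_iff comp_def)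
  moreover have "\<forall>g\<in>set ?gs. (k, g) \<in> C"
    using assms(1,3) by (auto simp: clone_def Pi_iff)
  ultimately show ?thesis
    using assms(1,2) by (simp add: clone_def)
qed

text \<open>The \<open>k\<close>-ary minors of an operation are minors of its \<open>K\<close>-ary minors.\<close>

lemma determined_by_minors_mono:
  assumes C: "clone B C" and det: "determined_by_minors B C k" and "1 \<le> k" "k \<le> K"
  shows "determined_by_minors B C K"
  unfolding determined_by_minors_def
proof (clarify)
  fix m f
  assume f: "(m, f) \<in> operations B"
    and min: "\<forall>\<sigma>\<in>{..<m} \<rightarrow> {..<K}. (K, minor B m K \<sigma> f) \<in> C"
  have "(k, minor B m k \<sigma> f) \<in> C" if \<sigma>: "\<sigma> \<in> {..<m} \<rightarrow> {..<k}" for \<sigma>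
  proof -
    \<comment> \<open>Positions from \<open>k\<close> on are not hit by \<open>\<sigma>\<close>; the value \<open>0\<close> there is admissible as \<open>k \<ge> 1\<close>.\<close>
    let ?\<tau> = "\<lambda>i. if i < k then i else 0"
    have \<tau>: "?\<tau> \<in> {..<K} \<rightarrow> {..<k}"
      using assms(3) by auto
    have \<sigma>K: "\<sigma> \<in> {..<m} \<rightarrow> {..<K}"
      using \<sigma> assms(4) by (auto simp: Pi_iff intro: less_le_trans)
    have "minor B m k \<sigma> f xs = minor B K k ?\<tau> (minor B m K \<sigma> f) xs" for xs
    proof (cases "xs \<in> tuples B k")
      case True
      have "map (\<lambda>i. map (\<lambda>i. xs ! ?\<tau> i) [0..<K] ! \<sigma> i) [0..<m] = map (\<lambda>i. xs ! \<sigma> i) [0..<m]"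
        using \<sigma> \<sigma>K by (auto simp: Pi_iff)
      then show ?thesis
        using True tuples_reindex[OF True \<tau>] by (simp only: minor_def restrict_apply if_True)
    qed (simp add: minor_def)
    then have "minor B m k \<sigma> f = minor B K k ?\<tau> (minor B m K \<sigma> f)" ..
    then show ?thesis
      using clone_minor[OF C _ \<tau>] min \<sigma>K by simp
  qed
  then show "(m, f) \<in> C"
    using det f by (auto simp: determined_by_minors_def)
qed

lemma preserves_minors_imp_preserves:
  assumes f: "(m, f) \<in> operations B" and R: "R \<subseteq> tuples B r" "finite R" "card R \<le> k"
    and min: "\<forall>\<sigma>\<in>{..<m} \<rightarrow> {..<k}. preserves (k, minor B m k \<sigma> f) (r, R)"
  shows "preserves (m, f) (r, R)"
  unfolding preserves_def
proof (clarify)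
  fix ts assume ts: "m = length ts" "set ts \<subseteq> R"
  have "ts \<noteq> []"
    using f ts(1) by (auto simp: operations_def)
  moreover have "card (set ts) \<le> k"
    using card_mono[OF R(2) ts(2)] R(3) by simp
  ultimately obtain us \<sigma> where us: "length us = k" "set us \<subseteq> set ts"
    and \<sigma>: "\<sigma> \<in> {..<m} \<rightarrow> {..<k}" and eq: "ts = map (\<lambda>i. us ! \<sigma> i) [0..<m]"
    using list_reindex_short ts(1) by metis
  have "map (\<lambda>j. minor B m k \<sigma> f (map (\<lambda>t. t ! j) us)) [0..<r] \<in> R"
    using min \<sigma> us ts(2) by (auto simp: preserves_def)
  moreover have "minor B m k \<sigma> f (map (\<lambda>t. t ! j) us) = f (map (\<lambda>t. t ! j) ts)" if "j < r" for j
  proof -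
    have "t ! j \<in> B" if "t \<in> set us" for t
    proof -
      have "t \<in> tuples B r"
        using that us(2) ts(2) R(1) by blast
      then show ?thesis
        using \<open>j < r\<close> by (auto simp: tuples_def)
    qed
    then have "map (\<lambda>t. t ! j) us \<in> tuples B k"
      using us(1) by (auto simp: tuples_def)
    moreover have "map (\<lambda>i. map (\<lambda>t. t ! j) us ! \<sigma> i) [0..<m] = map (\<lambda>t. t ! j) ts"
      using \<sigma> us(1) by (subst eq) (auto simp: Pi_iff)
    ultimately show ?thesis
      by (simp add: minor_def)
  qed
  then have "map (\<lambda>j. minor B m k \<sigma> f (map (\<lambda>t. t ! j) us)) [0..<r] =
      map (\<lambda>j. f (map (\<lambda>t. t ! j) ts)) [0..<r]"
    by (intro map_cong) auto
  ultimately show "map (\<lambda>j. f (map (\<lambda>t. t ! j) ts)) [0..<r] \<in> R"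
    by (simp only:)
qed

text \<open>The relation lists the value tables of the \<open>k\<close>-ary members of the clone.  Applying an
  operation to the tables of projections yields the table of a minor.\<close>

lemma determined_by_minors_imp_Pol:
  assumes B: "finite B" and C: "clone B C" and det: "determined_by_minors B C k"
  shows "\<exists>R\<in>relations B. C = Pol B {R}"
proof -
  obtain T where T: "set T = tuples B k"
    using finite_list[OF finite_tuples[OF B]] by blast
  define R where "R = (\<lambda>g. map g T) ` {g. (k, g) \<in> C}"
  have CO: "C \<subseteq> operations B"
    using C by (simp add: clone_def)
  have "R \<subseteq> tuples B (length T)"
  proof
    fix t assume "t \<in> R"
    then obtain g where "(k, g) \<in> C" and t: "t = map g T"
      by (auto simp: R_def)
    then have "g \<in> tuples B k \<rightarrow> B"
      using CO by (auto simp: operations_def PiE_iff)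
    then show "t \<in> tuples B (length T)"
      unfolding t by (intro tuples_map) (auto simp: tuples_def[of "tuples B k"] T)
  qed
  moreover have "C = Pol B {(length T, R)}"
  proof (intro equalityI subsetI)
    fix p assume p: "p \<in> C"
    obtain m f where p_eq: "p = (m, f)" by force
    have "map (\<lambda>j. f (map (\<lambda>t. t ! j) ts)) [0..<length T] \<in> R"
      if ts: "length ts = m" "set ts \<subseteq> R" for ts
    proof -
      have "\<forall>t\<in>set ts. \<exists>g. (k, g) \<in> C \<and> t = map g T"
        using ts(2) by (auto simp: R_def)
      then obtain G where G: "\<forall>t\<in>set ts. (k, G t) \<in> C \<and> t = map (G t) T"
        by metis
      let ?g = "superpose B k f (map G ts)"
      have "(k, ?g) \<in> C"
        using C p p_eq ts(1) G by (auto simp: clone_def)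
      moreover have "f (map (\<lambda>t. t ! j) ts) = ?g (T ! j)" if "j < length T" for j
      proof -
        have "T ! j \<in> tuples B k"
          using that T nth_mem by blast
        moreover have "t ! j = G t (T ! j)" if "t \<in> set ts" for t
          using G that \<open>j < length T\<close> by (metis nth_map)
        then have "map (\<lambda>t. t ! j) ts = map (\<lambda>g. g (T ! j)) (map G ts)"
          by simp
        ultimately show ?thesis
          by (simp only: superpose_def restrict_apply if_True)
      qed
      then have "map (\<lambda>j. f (map (\<lambda>t. t ! j) ts)) [0..<length T] = map ?g T"
        by (intro nth_equalityI) auto
      ultimately show ?thesis
        by (auto simp: R_def)
    qed
    then show "p \<in> Pol B {(length T, R)}"
      using p p_eq CO by (auto simp: Pol_def preserves_def)
  next
    fix p assume p: "p \<in> Pol B {(length T, R)}"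
    obtain m f where p_eq: "p = (m, f)" by force
    have f: "(m, f) \<in> operations B" and pres: "preserves (m, f) (length T, R)"
      using p p_eq by (auto simp: Pol_def)
    have "(k, minor B m k \<sigma> f) \<in> C" if \<sigma>: "\<sigma> \<in> {..<m} \<rightarrow> {..<k}" for \<sigma>
    proof -
      let ?ts = "map (\<lambda>i. map (proj B k (\<sigma> i)) T) [0..<m]"
      have "length ?ts = m \<and> set ?ts \<subseteq> R"
        using \<sigma> C by (auto simp: R_def clone_def Pi_iff)
      then have "map (\<lambda>j. f (map (\<lambda>t. t ! j) ?ts)) [0..<length T] \<in> R"
        using pres unfolding preserves_def prod.case by blast
      then obtain g where g: "(k, g) \<in> C"
        and eq: "map (\<lambda>j. f (map (\<lambda>t. t ! j) ?ts)) [0..<length T] = map g T"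
        unfolding R_def by blast
      have "minor B m k \<sigma> f xs = g xs" for xs
      proof (cases "xs \<in> tuples B k")
        case True
        then obtain j where j: "j < length T" "T ! j = xs"
          using T by (metis in_set_conv_nth)
        have "g xs = map g T ! j"
          using j by simp
        also have "\<dots> = f (map (\<lambda>t. t ! j) ?ts)"
          unfolding eq[symmetric] using j by simp
        also have "map (\<lambda>t. t ! j) ?ts = map (\<lambda>i. xs ! \<sigma> i) [0..<m]"
          using j True by (simp add: proj_def)
        also have "f \<dots> = minor B m k \<sigma> f xs"
          using True by (simp add: minor_def)
        finally show ?thesis ..
      next
        case False
        then show ?thesis
          using g CO by (auto simp: minor_def operations_def PiE_iff extensional_def)
      qed
      then have "minor B m k \<sigma> f = g" ..
      then show ?thesis
        using g by simp
    qed
    then show "p \<in> C"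
      using det f p_eq by (auto simp: determined_by_minors_def)
  qed
  ultimately show ?thesis
    by (intro bexI[of _ "(length T, R)"]) (auto simp: relations_def)
qed

lemma finitely_related_clone_iff:
  assumes B: "finite B" and C: "clone B C"
  shows "finitely_related_clone B C \<longleftrightarrow> (\<exists>k\<ge>1. determined_by_minors B C k)"
proof
  assume "finitely_related_clone B C"
  then obtain Rs where Rs: "finite Rs" "Rs \<subseteq> relations B" "C = Pol B Rs"
    by (auto simp: finitely_related_clone_def)
  \<comment> \<open>A common bound on the sizes of the relations, positive even if there are none.\<close>
  define k where "k = Suc (\<Sum>R\<in>Rs. card (snd R))"
  have "(m, f) \<in> C" if f: "(m, f) \<in> operations B"
    and min: "\<forall>\<sigma>\<in>{..<m} \<rightarrow> {..<k}. (k, minor B m k \<sigma> f) \<in> C" for m f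
  proof -
    have "preserves (m, f) (r, R)" if R: "(r, R) \<in> Rs" for r R
    proof (rule preserves_minors_imp_preserves[OF f])
      show sub: "R \<subseteq> tuples B r"
        using R Rs(2) by (auto simp: relations_def)
      show "finite R"
        using sub finite_tuples[OF B] by (rule finite_subset)
      show "card R \<le> k"
        using member_le_sum[OF R, of "\<lambda>R. card (snd R)"] Rs(1) by (simp add: k_def)
      show "\<forall>\<sigma>\<in>{..<m} \<rightarrow> {..<k}. preserves (k, minor B m k \<sigma> f) (r, R)"
        using min R unfolding Rs(3) by (auto simp: Pol_def)
    qed
    then show ?thesis
      using f unfolding Rs(3) by (auto simp: Pol_def)
  qed
  then have "determined_by_minors B C k"
    by (auto simp: determined_by_minors_def)
  then show "\<exists>k\<ge>1. determined_by_minors B C k"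
    by (intro exI[of _ k]) (simp add: k_def)
next
  assume "\<exists>k\<ge>1. determined_by_minors B C k"
  then obtain R where "R \<in> relations B" "C = Pol B {R}"
    using determined_by_minors_imp_Pol[OF B C] by blast
  then show "finitely_related_clone B C"
    using C unfolding finitely_related_clone_def by blast
qed

section \<open>Algebras separated by homomorphisms\<close>

definition homs :: "'f signature \<Rightarrow> ('f, 'b) ualgebra \<Rightarrow> ('f, 'a) ualgebra \<Rightarrow> ('b \<Rightarrow> 'a) set" where
  "homs \<Sigma> B A = {h \<in> univ B \<rightarrow> univ A. \<forall>f\<in>symbs \<Sigma>. \<forall>xs\<in>tuples (univ B) (arity \<Sigma> f).
     h (interp B f xs) = interp A f (map h xs)}"

lemma hom_term_eval:
  assumes B: "is_algebra \<Sigma> B" and h: "h \<in> homs \<Sigma> B A"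
    and t: "t \<in> terms \<Sigma> m" and e: "\<forall>i<m. e i \<in> univ B"
  shows "h (term_eval B e t) = term_eval A (\<lambda>i. h (e i)) t"
  using t
proof (induction rule: terms.induct)
  case (App f ts)
  have "map (term_eval B e) ts \<in> tuples (univ B) (arity \<Sigma> f)"
    using App term_eval_in_univ[OF B _ e] by (auto simp: tuples_def)
  then have "h (interp B f (map (term_eval B e) ts)) = interp A f (map h (map (term_eval B e) ts))"
    using h App.hyps(1) unfolding homs_def by blast
  also have "map h (map (term_eval B e) ts) = map (term_eval A (\<lambda>i. h (e i))) ts"
    using App by simp
  finally show ?case
    by (simp only: term_eval.simps)
qed simp

lemma term_op_in_operations:
  assumes "is_algebra \<Sigma> A" "t \<in> terms \<Sigma> m" "1 \<le> m"
  shows "(m, term_op A m t) \<in> operations (univ A)"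
  using clone_Clo[OF assms(1)] assms(2,3) by (auto simp: clone_def Clo_def)

lemma operation_eqI:
  assumes "(m, f) \<in> operations B" "(m, g) \<in> operations B" "\<And>xs. xs \<in> tuples B m \<Longrightarrow> f xs = g xs"
  shows "f = g"
  using assms by (auto simp: operations_def intro: PiE_ext)

text \<open>In other words, \<open>A\<close> is a homomorphic image of \<open>B\<close>, and \<open>B\<close> embeds into a power of \<open>A\<close>, so that
  \<open>A\<close> and \<open>B\<close> generate the same variety.\<close>

locale separated_by_homs =
  fixes \<Sigma> :: "'f signature" and A :: "('f, 'a) ualgebra" and B :: "('f, 'b) ualgebra"
    and H :: "('b \<Rightarrow> 'a) set"
  assumes alg_A: "is_algebra \<Sigma> A" and alg_B: "is_algebra \<Sigma> B" and finite_B: "finite (univ B)"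
    and homs: "H \<subseteq> homs \<Sigma> B A"
    and separating: "\<And>x y. x \<in> univ B \<Longrightarrow> y \<in> univ B \<Longrightarrow> \<forall>h\<in>H. h x = h y \<Longrightarrow> x = y"
    and surjective: "\<exists>h\<in>H. h ` univ B = univ A"
begin

definition intertwined :: "nat \<Rightarrow> ('a list \<Rightarrow> 'a) \<Rightarrow> ('b list \<Rightarrow> 'b) \<Rightarrow> bool" where
  "intertwined m f' f \<longleftrightarrow> (\<forall>h\<in>H. \<forall>xs\<in>tuples (univ B) m. f' (map h xs) = h (f xs))"

lemma hom_funcset: "h \<in> H \<Longrightarrow> h \<in> univ B \<rightarrow> univ A"
  using homs by (auto simp: homs_def)

lemma finite_A: "finite (univ A)"
  using surjective finite_B by (metis finite_imageI)

lemma lift_tuple: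
  assumes "h ` univ B = univ A" "ys \<in> tuples (univ A) m"
  obtains xs where "xs \<in> tuples (univ B) m" "map h xs = ys"
proof
  show "map (inv_into (univ B) h) ys \<in> tuples (univ B) m"
    using assms by (auto simp: tuples_def inv_into_into)
  show "map h (map (inv_into (univ B) h) ys) = ys"
    using assms by (auto simp: tuples_def subset_iff f_inv_into_f intro!: map_idI)
qed

lemma intertwined_term_op:
  assumes t: "t \<in> terms \<Sigma> m"
  shows "intertwined m (term_op A m t) (term_op B m t)"
  unfolding intertwined_def
proof (intro ballI)
  fix h xs assume h: "h \<in> H" and xs: "xs \<in> tuples (univ B) m"
  have "\<forall>i<m. xs ! i \<in> univ B"
    using xs by (auto simp: tuples_def)
  then have "h (term_op B m t xs) = term_eval A (\<lambda>i. h (xs ! i)) t"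
    using xs hom_term_eval[OF alg_B subsetD[OF homs h] t] by (simp add: term_op_def)
  also have "\<dots> = term_eval A (\<lambda>i. map h xs ! i) t"
    using xs by (intro term_eval_cong[OF t]) (auto simp: tuples_def)
  also have "\<dots> = term_op A m t (map h xs)"
    using tuples_map[OF xs hom_funcset[OF h]] by (simp add: term_op_def)
  finally show "term_op A m t (map h xs) = h (term_op B m t xs)" ..
qed

lemma intertwined_minor:
  assumes "intertwined m f' f" and \<sigma>: "\<sigma> \<in> {..<m} \<rightarrow> {..<k}"
  shows "intertwined k (minor (univ A) m k \<sigma> f') (minor (univ B) m k \<sigma> f)"
  unfolding intertwined_def
proof (intro ballI)
  fix h xs assume h: "h \<in> H" and xs: "xs \<in> tuples (univ B) k"
  have "minor (univ A) m k \<sigma> f' (map h xs) = f' (map (\<lambda>i. map h xs ! \<sigma> i) [0..<m])"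
    using tuples_map[OF xs hom_funcset[OF h]] by (simp add: minor_def)
  also have "map (\<lambda>i. map h xs ! \<sigma> i) [0..<m] = map h (map (\<lambda>i. xs ! \<sigma> i) [0..<m])"
    using \<sigma> xs by (auto simp: tuples_def Pi_iff)
  also have "f' \<dots> = h (f (map (\<lambda>i. xs ! \<sigma> i) [0..<m]))"
    using assms(1) h tuples_reindex[OF xs \<sigma>] unfolding intertwined_def by blast
  also have "\<dots> = h (minor (univ B) m k \<sigma> f xs)"
    using xs by (simp add: minor_def)
  finally show "minor (univ A) m k \<sigma> f' (map h xs) = h (minor (univ B) m k \<sigma> f xs)" .
qed

text \<open>In an intertwined pair the operation on \<open>A\<close> is determined by the one on \<open>B\<close> because
  some \<open>h\<close> is onto, and conversely because \<open>H\<close> separates points; hence a term that induces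
  one of them induces the other.\<close>

lemma intertwined_Clo_iff:
  assumes f': "(m, f') \<in> operations (univ A)" and f: "(m, f) \<in> operations (univ B)"
    and int: "intertwined m f' f"
  shows "(m, f') \<in> Clo \<Sigma> A \<longleftrightarrow> (m, f) \<in> Clo \<Sigma> B"
proof -
  have "f' = term_op A m t \<longleftrightarrow> f = term_op B m t" if t: "t \<in> terms \<Sigma> m" "1 \<le> m" for t
  proof
    note tB = term_op_in_operations[OF alg_B t]
    assume eq: "f' = term_op A m t"
    show "f = term_op B m t"
    proof (rule operation_eqI[OF f tB])
      fix xs assume xs: "xs \<in> tuples (univ B) m"
      show "f xs = term_op B m t xs"
      proof (rule separating)
        show "f xs \<in> univ B" "term_op B m t xs \<in> univ B"
          using f tB xs by (auto simp: operations_def)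
        show "\<forall>h\<in>H. h (f xs) = h (term_op B m t xs)"
          using int intertwined_term_op[OF t(1)] xs by (simp add: intertwined_def eq)
      qed
    qed
  next
    assume eq: "f = term_op B m t"
    obtain h where h: "h \<in> H" "h ` univ B = univ A"
      using surjective by blast
    show "f' = term_op A m t"
    proof (rule operation_eqI[OF f' term_op_in_operations[OF alg_A t]])
      fix ys assume "ys \<in> tuples (univ A) m"
      then obtain xs where "xs \<in> tuples (univ B) m" "map h xs = ys"
        using lift_tuple[OF h(2)] by blast
      then show "f' ys = term_op A m t ys"
        using int intertwined_term_op[OF t(1)] h(1) by (auto simp: intertwined_def eq)
    qed
  qed
  then show ?thesis
    by (auto simp: Clo_def)
qed

lemma minor_in_operations:
  assumes "(m, f) \<in> operations U" "\<sigma> \<in> {..<m} \<rightarrow> {..<k}" "1 \<le> k"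
  shows "(k, minor U m k \<sigma> f) \<in> operations U"
  using assms tuples_reindex[OF _ assms(2)] by (auto simp: operations_def minor_def)

lemma intertwined_minor_Clo_iff:
  assumes "(m, f') \<in> operations (univ A)" "(m, f) \<in> operations (univ B)" "intertwined m f' f"
    "\<sigma> \<in> {..<m} \<rightarrow> {..<k}" "1 \<le> k"
  shows "(k, minor (univ A) m k \<sigma> f') \<in> Clo \<Sigma> A \<longleftrightarrow> (k, minor (univ B) m k \<sigma> f) \<in> Clo \<Sigma> B"
  using assms by (intro intertwined_Clo_iff minor_in_operations intertwined_minor)

text \<open>If \<open>h\<close> is onto then \<open>h xs \<mapsto> h (f xs)\<close> is the only possible partner of \<open>f\<close>.  That it does
  not depend on \<open>h\<close> and \<open>xs\<close> concerns two lists \<open>xs\<close>, \<open>ys\<close> over \<open>B\<close>; the list of pairs of their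
  entries has at most \<open>|B|\<^sup>2\<close> different entries, so that \<open>xs\<close> and \<open>ys\<close> arise from shorter lists by
  one common reindexing, and there \<open>f\<close> acts as a term.\<close>

lemma partner_on_A:
  assumes f: "(m, f) \<in> operations (univ B)" and K: "(card (univ B))\<^sup>2 \<le> K"
    and min: "\<forall>\<sigma>\<in>{..<m} \<rightarrow> {..<K}. (K, minor (univ B) m K \<sigma> f) \<in> Clo \<Sigma> B"
  obtains f' where "(m, f') \<in> operations (univ A)" "intertwined m f' f"
proof -
  have m: "1 \<le> m"
    using f by (simp add: operations_def)
  have key: "h (f xs) = h' (f ys)"
    if h: "h \<in> H" "h' \<in> H" and xs: "xs \<in> tuples (univ B) m" and ys: "ys \<in> tuples (univ B) m"
      and eq: "map h xs = map h' ys" for h h' xs ys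
  proof -
    have len: "length xs = m" "length ys = m"
      using xs ys by (auto simp: tuples_def)
    have sub: "set (zip xs ys) \<subseteq> univ B \<times> univ B"
      using xs ys by (auto simp: tuples_def dest: set_zip_leftD set_zip_rightD)
    have "card (set (zip xs ys)) \<le> K"
      using card_mono[OF _ sub] K finite_B by (simp add: card_cartesian_product power2_eq_square)
    moreover have "zip xs ys \<noteq> []"
      using m len by (auto simp: zip_eq_Nil_iff)
    ultimately obtain us \<sigma> where us: "length us = K" "set us \<subseteq> set (zip xs ys)"
      and \<sigma>: "\<sigma> \<in> {..<m} \<rightarrow> {..<K}" and z: "zip xs ys = map (\<lambda>i. us ! \<sigma> i) [0..<m]"
      using list_reindex_short[of "zip xs ys" K] len by auto
    have us_eq: "h (fst p) = h' (snd p)" if "p \<in> set us" for p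
    proof -
      have "p \<in> set (zip xs ys)"
        using that us(2) by blast
      then obtain i where "i < m" "p = (xs ! i, ys ! i)"
        using len by (auto simp: set_zip)
      then show ?thesis
        using arg_cong[OF eq, of "\<lambda>l. l ! i"] len by simp
    qed
    have us': "map fst us \<in> tuples (univ B) K" "map snd us \<in> tuples (univ B) K"
      using us sub by (auto simp: tuples_def)
    have "xs = map fst (zip xs ys)" "ys = map snd (zip xs ys)"
      using len by simp_all
    then have re: "xs = map (\<lambda>i. map fst us ! \<sigma> i) [0..<m]"
      "ys = map (\<lambda>i. map snd us ! \<sigma> i) [0..<m]"
      using \<sigma> us(1) unfolding z by (auto simp: Pi_iff)
    obtain t where t: "t \<in> terms \<Sigma> K" and tf: "minor (univ B) m K \<sigma> f = term_op B K t"
      using min \<sigma> by (auto simp: Clo_def)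
    have fx: "f xs = term_op B K t (map fst us)" "f ys = term_op B K t (map snd us)"
      using us' unfolding tf[symmetric] minor_def by (simp_all flip: re)
    have "h (f xs) = term_op A K t (map h (map fst us))"
      using intertwined_term_op[OF t] h us' unfolding fx intertwined_def by metis
    also have "map h (map fst us) = map h' (map snd us)"
      using us_eq by simp
    also have "term_op A K t \<dots> = h' (f ys)"
      using intertwined_term_op[OF t] h us' unfolding fx intertwined_def by metis
    finally show ?thesis .
  qed
  obtain h0 where h0: "h0 \<in> H" "h0 ` univ B = univ A"
    using surjective by blast
  let ?lift = "\<lambda>ys. SOME xs. xs \<in> tuples (univ B) m \<and> map h0 xs = ys"
  have lift: "?lift ys \<in> tuples (univ B) m \<and> map h0 (?lift ys) = ys"
    if ys: "ys \<in> tuples (univ A) m" for ys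
  proof -
    obtain xs where "xs \<in> tuples (univ B) m \<and> map h0 xs = ys"
      using lift_tuple[OF h0(2) ys] by blast
    then show ?thesis
      by (rule someI)
  qed
  define f' where "f' = (\<lambda>ys\<in>tuples (univ A) m. h0 (f (?lift ys)))"
  show thesis
  proof
    show "(m, f') \<in> operations (univ A)"
      using m f lift hom_funcset[OF h0(1)] by (auto simp: f'_def operations_def Pi_iff PiE_iff)
    show "intertwined m f' f"
      unfolding intertwined_def
    proof (intro ballI)
      fix h xs assume h: "h \<in> H" and xs: "xs \<in> tuples (univ B) m"
      note hx = tuples_map[OF xs hom_funcset[OF h]]
      show "f' (map h xs) = h (f xs)"
        using key[OF h0(1) h _ xs] lift[OF hx] hx by (simp add: f'_def)
    qed
  qed
qed

text \<open>Since \<open>B\<close> is separated by \<open>H\<close>, it behaves like a subalgebra of a power of \<open>A\<close>, and what is to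
  be shown is that it is closed under the coordinatewise action of \<open>f'\<close>.  A list over \<open>B\<close> has at
  most \<open>|B|\<close> different entries, so that on this list \<open>f'\<close> acts as a term.\<close>

lemma partner_on_B:
  assumes f': "(m, f') \<in> operations (univ A)" and K: "card (univ B) \<le> K" "1 \<le> K"
    and min: "\<forall>\<sigma>\<in>{..<m} \<rightarrow> {..<K}. (K, minor (univ A) m K \<sigma> f') \<in> Clo \<Sigma> A"
  obtains f where "(m, f) \<in> operations (univ B)" "intertwined m f' f"
proof -
  have m: "1 \<le> m"
    using f' by (simp add: operations_def)
  have "\<exists>y\<in>univ B. \<forall>h\<in>H. f' (map h xs) = h y" if xs: "xs \<in> tuples (univ B) m" for xs
  proof -
    have len: "length xs = m" and sub: "set xs \<subseteq> univ B"
      using xs by (auto simp: tuples_def)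
    have "card (set xs) \<le> K"
      using card_mono[OF finite_B sub] K(1) by simp
    moreover have "xs \<noteq> []"
      using m len by auto
    ultimately obtain us \<sigma> where us: "length us = K" "set us \<subseteq> set xs"
      and \<sigma>: "\<sigma> \<in> {..<m} \<rightarrow> {..<K}" and z: "xs = map (\<lambda>i. us ! \<sigma> i) [0..<m]"
      using list_reindex_short[of xs K] len by auto
    have us': "us \<in> tuples (univ B) K"
      using us sub by (auto simp: tuples_def)
    obtain t where t: "t \<in> terms \<Sigma> K" and tf: "minor (univ A) m K \<sigma> f' = term_op A K t"
      using min \<sigma> by (auto simp: Clo_def)
    have "f' (map h xs) = h (term_op B K t us)" if h: "h \<in> H" for h
    proof -
      have "map h xs = map (\<lambda>i. map h us ! \<sigma> i) [0..<m]"
        using \<sigma> us(1) by (subst z) (auto simp: Pi_iff)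
      then have "f' (map h xs) = minor (univ A) m K \<sigma> f' (map h us)"
        using tuples_map[OF us' hom_funcset[OF h]] by (simp add: minor_def)
      also have "\<dots> = h (term_op B K t us)"
        using intertwined_term_op[OF t] h us' by (simp add: tf intertwined_def)
      finally show ?thesis .
    qed
    moreover have "term_op B K t us \<in> univ B"
      using term_op_in_operations[OF alg_B t K(2)] us' by (auto simp: operations_def)
    ultimately show ?thesis
      by blast
  qed
  then obtain F where F: "\<And>xs. xs \<in> tuples (univ B) m \<Longrightarrow>
      F xs \<in> univ B \<and> (\<forall>h\<in>H. f' (map h xs) = h (F xs))"
    by metis
  show thesis
  proof
    show "(m, restrict F (tuples (univ B) m)) \<in> operations (univ B)"
      using m F by (auto simp: operations_def)
    show "intertwined m f' (restrict F (tuples (univ B) m))"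
      using F by (simp add: intertwined_def)
  qed
qed

lemma determined_by_minors_iff:
  assumes K: "(card (univ B))\<^sup>2 \<le> K" "1 \<le> K"
  shows "determined_by_minors (univ A) (Clo \<Sigma> A) K \<longleftrightarrow>
    determined_by_minors (univ B) (Clo \<Sigma> B) K"
proof
  assume A: "determined_by_minors (univ A) (Clo \<Sigma> A) K"
  show "determined_by_minors (univ B) (Clo \<Sigma> B) K"
    unfolding determined_by_minors_def
  proof (clarify)
    fix m f
    assume f: "(m, f) \<in> operations (univ B)"
      and min: "\<forall>\<sigma>\<in>{..<m} \<rightarrow> {..<K}. (K, minor (univ B) m K \<sigma> f) \<in> Clo \<Sigma> B"
    obtain f' where f': "(m, f') \<in> operations (univ A)" "intertwined m f' f"
      using partner_on_A[OF f K(1) min] .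
    have "(m, f') \<in> Clo \<Sigma> A"
      using A f'(1) min intertwined_minor_Clo_iff[OF f'(1) f f'(2) _ K(2)]
      by (auto simp: determined_by_minors_def)
    then show "(m, f) \<in> Clo \<Sigma> B"
      using intertwined_Clo_iff[OF f'(1) f f'(2)] by simp
  qed
next
  assume B: "determined_by_minors (univ B) (Clo \<Sigma> B) K"
  have K': "card (univ B) \<le> K"
    using le_square K(1) unfolding power2_eq_square by (rule le_trans)
  show "determined_by_minors (univ A) (Clo \<Sigma> A) K"
    unfolding determined_by_minors_def
  proof (clarify)
    fix m f'
    assume f': "(m, f') \<in> operations (univ A)"
      and min: "\<forall>\<sigma>\<in>{..<m} \<rightarrow> {..<K}. (K, minor (univ A) m K \<sigma> f') \<in> Clo \<Sigma> A"
    obtain f where f: "(m, f) \<in> operations (univ B)" "intertwined m f' f"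
      using partner_on_B[OF f' K' K(2) min] .
    have "(m, f) \<in> Clo \<Sigma> B"
      using B f(1) min intertwined_minor_Clo_iff[OF f' f(1) f(2) _ K(2)]
      by (auto simp: determined_by_minors_def)
    then show "(m, f') \<in> Clo \<Sigma> A"
      using intertwined_Clo_iff[OF f' f(1) f(2)] by simp
  qed
qed

theorem finitely_related_iff: "finitely_related \<Sigma> A \<longleftrightarrow> finitely_related \<Sigma> B"
proof -
  have "(\<exists>k\<ge>1. determined_by_minors (univ A) (Clo \<Sigma> A) k) \<longleftrightarrow>
    (\<exists>k\<ge>1. determined_by_minors (univ B) (Clo \<Sigma> B) k)"
  proof
    assume "\<exists>k\<ge>1. determined_by_minors (univ A) (Clo \<Sigma> A) k"
    then obtain k where k: "1 \<le> k" "determined_by_minors (univ A) (Clo \<Sigma> A) k"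
      by blast
    have "determined_by_minors (univ A) (Clo \<Sigma> A) (k + (card (univ B))\<^sup>2)"
      by (rule determined_by_minors_mono[OF clone_Clo[OF alg_A] k(2,1)]) simp
    then have "determined_by_minors (univ B) (Clo \<Sigma> B) (k + (card (univ B))\<^sup>2)"
      using determined_by_minors_iff[OF le_add2 le_trans[OF k(1) le_add1]] by blast
    then show "\<exists>k\<ge>1. determined_by_minors (univ B) (Clo \<Sigma> B) k"
      using le_trans[OF k(1) le_add1] by blast
  next
    assume "\<exists>k\<ge>1. determined_by_minors (univ B) (Clo \<Sigma> B) k"
    then obtain k where k: "1 \<le> k" "determined_by_minors (univ B) (Clo \<Sigma> B) k"
      by blast
    have "determined_by_minors (univ B) (Clo \<Sigma> B) (k + (card (univ B))\<^sup>2)"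
      by (rule determined_by_minors_mono[OF clone_Clo[OF alg_B] k(2,1)]) simp
    then have "determined_by_minors (univ A) (Clo \<Sigma> A) (k + (card (univ B))\<^sup>2)"
      using determined_by_minors_iff[OF le_add2 le_trans[OF k(1) le_add1]] by blast
    then show "\<exists>k\<ge>1. determined_by_minors (univ A) (Clo \<Sigma> A) k"
      using le_trans[OF k(1) le_add1] by blast
  qed
  then show ?thesis
    unfolding finitely_related_def
    by (simp add: finitely_related_clone_iff[OF finite_A clone_Clo[OF alg_A]]
        finitely_related_clone_iff[OF finite_B clone_Clo[OF alg_B]])
qed

end

section \<open>Evaluation homomorphisms of the free algebra\<close>

definition class_eval :: "('f, 'a) ualgebra \<Rightarrow> (nat \<Rightarrow> 'a) \<Rightarrow> 'f trm set \<Rightarrow> 'a" where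
  "class_eval A e c = term_eval A e (SOME t. t \<in> c)"

lemma class_eval_class:
  assumes e: "range e \<subseteq> univ A" and t: "t \<in> terms \<Sigma> n"
  shows "class_eval A e (term_equiv \<Sigma> A n `` {t}) = term_eval A e t"
proof -
  let ?s = "SOME s. s \<in> term_equiv \<Sigma> A n `` {t}"
  have "t \<in> term_equiv \<Sigma> A n `` {t}"
    using equiv_class_self[OF equiv_term_equiv t] .
  then have "?s \<in> term_equiv \<Sigma> A n `` {t}"
    by (rule someI)
  then show ?thesis
    using e by (auto simp: term_equiv_def satisfies_def class_eval_def)
qed

lemma univ_free_algebraE:
  assumes "c \<in> univ (free_algebra \<Sigma> A n)"
  obtains t where "t \<in> terms \<Sigma> n" "c = term_equiv \<Sigma> A n `` {t}"
  using assms by (auto simp: free_algebra_def elim: quotientE)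

lemma class_in_univ: "t \<in> terms \<Sigma> n \<Longrightarrow> term_equiv \<Sigma> A n `` {t} \<in> univ (free_algebra \<Sigma> A n)"
  by (simp add: free_algebra_def quotientI)

lemma class_eval_hom:
  assumes A: "is_algebra \<Sigma> A" and e: "range e \<subseteq> univ A"
  shows "class_eval A e \<in> homs \<Sigma> (free_algebra \<Sigma> A n) A"
  unfolding homs_def
proof (intro CollectI conjI funcsetI ballI)
  fix c assume "c \<in> univ (free_algebra \<Sigma> A n)"
  then obtain t where t: "t \<in> terms \<Sigma> n" "c = term_equiv \<Sigma> A n `` {t}"
    by (rule univ_free_algebraE)
  have "term_eval A e t \<in> univ A"
    using e by (intro term_eval_in_univ[OF A t(1)]) auto
  then show "class_eval A e c \<in> univ A"
    using class_eval_class[OF e t(1)] t(2) by simp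
next
  fix f cs
  assume f: "f \<in> symbs \<Sigma>" and cs: "cs \<in> tuples (univ (free_algebra \<Sigma> A n)) (arity \<Sigma> f)"
  have "\<forall>c\<in>set cs. \<exists>t. t \<in> terms \<Sigma> n \<and> c = term_equiv \<Sigma> A n `` {t}"
    using cs by (auto simp: tuples_def elim: univ_free_algebraE)
  then obtain g where g: "\<forall>c\<in>set cs. g c \<in> terms \<Sigma> n \<and> c = term_equiv \<Sigma> A n `` {g c}"
    by metis
  define ts where "ts = map g cs"
  have ts: "length ts = arity \<Sigma> f" "set ts \<subseteq> terms \<Sigma> n"
    using g cs by (auto simp: ts_def tuples_def)
  have cs_eq: "cs = map (\<lambda>t. term_equiv \<Sigma> A n `` {t}) ts"
    using g by (simp add: ts_def map_idI)
  have App: "App f ts \<in> terms \<Sigma> n"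
    using f ts by (intro terms.App) auto
  have evs: "map (class_eval A e) cs = map (term_eval A e) ts"
    using ts(2) class_eval_class[OF e] unfolding cs_eq by auto
  show "class_eval A e (interp (free_algebra \<Sigma> A n) f cs) = interp A f (map (class_eval A e) cs)"
    unfolding evs unfolding cs_eq
    by (simp add: interp_free_algebra[OF f ts] class_eval_class[OF e App])
qed

lemma class_evals_separate:
  assumes c: "c \<in> univ (free_algebra \<Sigma> A n)" and d: "d \<in> univ (free_algebra \<Sigma> A n)"
    and eq: "\<And>e. range e \<subseteq> univ A \<Longrightarrow> class_eval A e c = class_eval A e d"
  shows "c = d"
proof -
  obtain s where s: "s \<in> terms \<Sigma> n" "c = term_equiv \<Sigma> A n `` {s}"
    using c by (rule univ_free_algebraE)
  obtain t where t: "t \<in> terms \<Sigma> n" "d = term_equiv \<Sigma> A n `` {t}"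
    using d by (rule univ_free_algebraE)
  have "satisfies A s t"
    unfolding satisfies_def using eq class_eval_class s t by metis
  then have "(s, t) \<in> term_equiv \<Sigma> A n"
    using s t by (simp add: term_equiv_def)
  then show ?thesis
    using equiv_class_eq[OF equiv_term_equiv] s t by metis
qed

text \<open>A class is determined by the \<open>n\<close>-ary term operation that its members induce on \<open>A\<close>.\<close>

lemma finite_free_algebra:
  assumes A: "is_algebra \<Sigma> A" and fin: "finite (univ A)" and n: "1 \<le> n"
  shows "finite (univ (free_algebra \<Sigma> A n))"
proof (rule finite_surj)
  let ?class = "\<lambda>f. {t \<in> terms \<Sigma> n. term_op A n t = f}"
  show "finite (tuples (univ A) n \<rightarrow>\<^sub>E univ A)"
    using fin finite_tuples[OF fin] by (intro finite_PiE) auto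
  have "term_equiv \<Sigma> A n `` {t} = ?class (term_op A n t)" if t: "t \<in> terms \<Sigma> n" for t
  proof -
    have "satisfies A t s \<longleftrightarrow> term_op A n s = term_op A n t" if s: "s \<in> terms \<Sigma> n" for s
    proof
      assume sat: "satisfies A t s"
      show "term_op A n s = term_op A n t"
        unfolding term_op_def
      proof (rule restrict_ext)
        fix xs assume xs: "xs \<in> tuples (univ A) n"
        \<comment> \<open>An assignment of \<open>satisfies\<close> is total on \<open>nat\<close>, so the list is padded by its head.\<close>
        let ?e = "\<lambda>i. if i < n then xs ! i else xs ! 0"
        have "xs ! i \<in> univ A" if "i < n" for i
          using that xs by (auto simp: tuples_def)
        then have "range ?e \<subseteq> univ A"
          using n by auto
        then have "term_eval A ?e t = term_eval A ?e s"
          using sat by (simp add: satisfies_def)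
        then show "term_eval A (\<lambda>i. xs ! i) s = term_eval A (\<lambda>i. xs ! i) t"
          using term_eval_cong[OF s, of ?e "\<lambda>i. xs ! i" A]
            term_eval_cong[OF t, of ?e "\<lambda>i. xs ! i" A] by simp
      qed
    next
      assume eq: "term_op A n s = term_op A n t"
      show "satisfies A t s"
        unfolding satisfies_def
      proof (intro allI impI)
        fix e :: "nat \<Rightarrow> 'b" assume e: "range e \<subseteq> univ A"
        let ?xs = "map e [0..<n]"
        have "?xs \<in> tuples (univ A) n"
          using e by (auto simp: tuples_def)
        then have "term_eval A (\<lambda>i. ?xs ! i) s = term_eval A (\<lambda>i. ?xs ! i) t"
          using fun_cong[OF eq, of ?xs] by (simp add: term_op_def)
        then show "term_eval A e t = term_eval A e s"
          using term_eval_cong[OF s, of e "\<lambda>i. ?xs ! i" A]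
            term_eval_cong[OF t, of e "\<lambda>i. ?xs ! i" A] by simp
      qed
    qed
    then show ?thesis
      using t by (auto simp: term_equiv_def)
  qed
  moreover have "term_op A n t \<in> tuples (univ A) n \<rightarrow>\<^sub>E univ A" if "t \<in> terms \<Sigma> n" for t
    using term_op_in_operations[OF A that n] by (simp add: operations_def)
  ultimately show "univ (free_algebra \<Sigma> A n) \<subseteq> ?class ` (tuples (univ A) n \<rightarrow>\<^sub>E univ A)"
    by (auto elim!: univ_free_algebraE)
qed

lemma class_eval_onto:
  assumes A: "is_algebra \<Sigma> A" and fin: "finite (univ A)" and card: "card (univ A) \<le> n"
  shows "\<exists>e. range e \<subseteq> univ A \<and> class_eval A e ` univ (free_algebra \<Sigma> A n) = univ A"
proof -
  obtain xs where xs: "set xs = univ A" "distinct xs"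
    using finite_distinct_list[OF fin] by blast
  have len: "length xs \<le> n"
    using card xs distinct_card by metis
  have ne: "xs \<noteq> []"
    using A xs by (auto simp: is_algebra_def)
  define e where "e = (\<lambda>i. if i < length xs then xs ! i else hd xs)"
  have e: "range e \<subseteq> univ A"
    using ne unfolding xs(1)[symmetric] by (auto simp: e_def)
  have "univ A \<subseteq> class_eval A e ` univ (free_algebra \<Sigma> A n)"
  proof
    fix a assume "a \<in> univ A"
    then obtain i where i: "i < length xs" "a = xs ! i"
      using xs(1) by (metis in_set_conv_nth)
    have var: "Var i \<in> terms \<Sigma> n"
      using i len by (intro terms.Var) simp
    have "a = class_eval A e (term_equiv \<Sigma> A n `` {Var i})"
      using class_eval_class[OF e var] i by (simp add: e_def)
    then show "a \<in> class_eval A e ` univ (free_algebra \<Sigma> A n)"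
      using class_in_univ[OF var] by (rule image_eqI)
  qed
  moreover have "class_eval A e ` univ (free_algebra \<Sigma> A n) \<subseteq> univ A"
    using class_eval_hom[OF A e, of n] by (auto simp: homs_def)
  ultimately show ?thesis
    using e by blast
qed

theorem theorem3p20:
  fixes \<Sigma> :: "'f signature" and A :: "('f, 'a) ualgebra" and n :: nat
  assumes "is_algebra \<Sigma> A"
    and "finite (univ A)"
    and "card (univ A) \<le> n"
  shows "finitely_related \<Sigma> A \<longleftrightarrow> finitely_related \<Sigma> (free_algebra \<Sigma> A n)"
proof -
  have "univ A \<noteq> {}"
    using assms(1) by (simp add: is_algebra_def)
  then have n: "1 \<le> n"
    using assms(2,3) by (metis card_gt_0_iff less_one linorder_not_le)
  interpret separated_by_homs \<Sigma> A "free_algebra \<Sigma> A n" "class_eval A ` {e. range e \<subseteq> univ A}"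
  proof
    show "is_algebra \<Sigma> A" "is_algebra \<Sigma> (free_algebra \<Sigma> A n)"
      using assms(1) is_algebra_free_algebra[OF n] .
    show "finite (univ (free_algebra \<Sigma> A n))"
      using finite_free_algebra[OF assms(1,2) n] .
    show "class_eval A ` {e. range e \<subseteq> univ A} \<subseteq> homs \<Sigma> (free_algebra \<Sigma> A n) A"
      using class_eval_hom[OF assms(1)] by blast
    show "c = d" if "c \<in> univ (free_algebra \<Sigma> A n)" "d \<in> univ (free_algebra \<Sigma> A n)"
      "\<forall>h\<in>class_eval A ` {e. range e \<subseteq> univ A}. h c = h d" for c d
      using class_evals_separate[OF that(1,2)] that(3) by blast
    show "\<exists>h\<in>class_eval A ` {e. range e \<subseteq> univ A}. h ` univ (free_algebra \<Sigma> A n) = univ A"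
      using class_eval_onto[OF assms] by blast
  qed
  show ?thesis
    by (rule finitely_related_iff)
qed

end
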